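(* Let $T$ be an infinite tree without terminal vertices, rooted at a vertex $o$, let $\psi$ be a complex-valued function on $T$, and let $m$ and $n$ be distinct non-negative integers. Define $$\mu_{\psi,m,n} = \sup_{v \in T^*} |\psi'(v)|\,\ell_m(|v|)\,\Lambda_n(|v|),\qquad \nu_{\psi,m,n} = \sup_{v \in T^*} \frac{|\psi (v^-)|\,\Lambda_n(|v|)}{\Lambda_m(|v|)}.$$ Then the multiplication operator $M_\psi:\mathcal{L}^{(m)} \to \mathcal{L}^{(n)}$ is bounded if and only if $\mu_{\psi,m,n}$ and $\nu_{\psi,m,n}$ are both finite. Furthermore, under these conditions, $$\|\psi\|_n \leq \|M_\psi\| \leq |\psi(o)| + \mu_{\psi,m,n} + \nu_{\psi,m,n},$$ where $\|M_\psi\|$ denotes the operator norm of $M_\psi:\mathcal{L}^{(m)} \to \mathcal{L}^{(n)}$.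
   Context: A tree $T$ is a locally finite, connected, simply connected graph, identified as a set with its collection of vertices. Two vertices are neighbors if there is an edge connecting them; a vertex is terminal if it has a unique neighbor. The distance $d(v,w)$ is the number of edges in the unique path connecting $v$ to $w$. The tree is rooted at a vertex $o$; put $|v| = d(o,v)$ and $T^* = T\setminus\{o\}$. For $v\in T^*$, $v^-$ denotes the unique neighbor of $v$ lying on the path from $o$ to $v$. A function on $T$ is a complex-valued function on the vertices. The discrete derivative of a function $f$ on $T$ is $f'(v) = f(v)-f(v^-)$ for $v\ne o$ and $f'(o)=0$. For $x \geq 1$ define recursively $\ell_0(x)=x$, $\ell_1(x)=1+\log x$, and $\ell_j(x)=1+\log \ell_{j-1}(x)$ for $j\geq 2$. Define $\Lambda_0(x)=1$ and $\Lambda_k(x)=\prod_{j=0}^{k-1}\ell_j(x)$ for $k\ge 1$. For a non-negative integer $k$, the iterated logarithmic Lipschitz space $\mathcal{L}^{(k)}$ is the set of functions $f$ on $T$ with $\sup_{v\in T^*}|f'(v)|\Lambda_k(|v|)<\infty$; it is a Banach space under the norm $\|f\|_k = |f(o)| + \sup_{v \in T^*} |f'(v)|\Lambda_k(|v|)$. The multiplication operator with symbol $\psi$ is $M_\psi f = \psi f$ (pointwise product). Saying that $M_\psi:\mathcal{L}^{(m)}\to\mathcal{L}^{(n)}$ is bounded means that $M_\psi$ maps $\mathcal{L}^{(m)}$ into $\mathcal{L}^{(n)}$ and is bounded with respect to the norms $\|\cdot\|_m$ and $\|\cdot\|_n$. *)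

theory Defs
  imports "HOL-Library.Extended_Real" Complex_Main
begin

section \<open>Trees\<close>

text \<open>
  The vertices of a tree are the elements of a type \<open>'v\<close>, so that a function on the tree is
  a function of type \<open>'v \<Rightarrow> complex\<close>; the tree is given by its adjacency relation.
  A path is the list of its pairwise distinct vertices, so it has one edge fewer than its length.
\<close>

definition is_path :: "('v \<Rightarrow> 'v \<Rightarrow> bool) \<Rightarrow> 'v \<Rightarrow> 'v \<Rightarrow> 'v list \<Rightarrow> bool" where
  "is_path adj v w p \<longleftrightarrow>
     p \<noteq> [] \<and> hd p = v \<and> last p = w \<and> successively adj p \<and> distinct p"

definition is_cycle :: "('v \<Rightarrow> 'v \<Rightarrow> bool) \<Rightarrow> 'v list \<Rightarrow> bool" where
  "is_cycle adj c \<longleftrightarrow>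
     length c \<ge> 3 \<and> distinct c \<and> successively adj c \<and> adj (last c) (hd c)"

text \<open>Simple connectedness of a graph means that it contains no cycle.\<close>

definition is_tree :: "('v \<Rightarrow> 'v \<Rightarrow> bool) \<Rightarrow> bool" where
  "is_tree adj \<longleftrightarrow>
     symp adj \<and> irreflp adj \<and>
     (\<forall>v. finite {w. adj v w}) \<and>
     (\<forall>v w. \<exists>p. is_path adj v w p) \<and>
     (\<nexists>c. is_cycle adj c)"

definition terminal :: "('v \<Rightarrow> 'v \<Rightarrow> bool) \<Rightarrow> 'v \<Rightarrow> bool" where
  "terminal adj v \<longleftrightarrow> (\<exists>!w. adj v w)"

definition tree_path :: "('v \<Rightarrow> 'v \<Rightarrow> bool) \<Rightarrow> 'v \<Rightarrow> 'v \<Rightarrow> 'v list" where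
  "tree_path adj v w = (THE p. is_path adj v w p)"

definition tree_dist :: "('v \<Rightarrow> 'v \<Rightarrow> bool) \<Rightarrow> 'v \<Rightarrow> 'v \<Rightarrow> nat" where
  "tree_dist adj v w = length (tree_path adj v w) - 1"

text \<open>In what follows \<open>r\<close> is the root, and \<open>parent adj r v\<close> is the vertex \<open>v\<^sup>-\<close> (for \<open>v \<noteq> r\<close>).\<close>

definition parent :: "('v \<Rightarrow> 'v \<Rightarrow> bool) \<Rightarrow> 'v \<Rightarrow> 'v \<Rightarrow> 'v" where
  "parent adj r v = (THE w. adj v w \<and> w \<in> set (tree_path adj r v))"

definition tree_deriv :: "('v \<Rightarrow> 'v \<Rightarrow> bool) \<Rightarrow> 'v \<Rightarrow> ('v \<Rightarrow> complex) \<Rightarrow> 'v \<Rightarrow> complex" where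
  "tree_deriv adj r f v = (if v = r then 0 else f v - f (parent adj r v))"


section \<open>Iterated logarithmic Lipschitz spaces\<close>

fun ell :: "nat \<Rightarrow> real \<Rightarrow> real" where
  "ell 0 x = x"
| "ell (Suc j) x = 1 + ln (ell j x)"

definition Lam :: "nat \<Rightarrow> real \<Rightarrow> real" where
  "Lam k x = (\<Prod>j<k. ell j x)"

definition lip_space :: "('v \<Rightarrow> 'v \<Rightarrow> bool) \<Rightarrow> 'v \<Rightarrow> nat \<Rightarrow> ('v \<Rightarrow> complex) set" where
  "lip_space adj r k =
     {f. bdd_above ((\<lambda>v. cmod (tree_deriv adj r f v) * Lam k (real (tree_dist adj r v))) ` (UNIV - {r}))}"

text \<open>The supremum of real numbers below is meaningful only for \<open>f \<in> lip_space adj r k\<close>.\<close>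

definition lip_norm :: "('v \<Rightarrow> 'v \<Rightarrow> bool) \<Rightarrow> 'v \<Rightarrow> nat \<Rightarrow> ('v \<Rightarrow> complex) \<Rightarrow> real" where
  "lip_norm adj r k f =
     cmod (f r) + (SUP v\<in>UNIV - {r}. cmod (tree_deriv adj r f v) * Lam k (real (tree_dist adj r v)))"


section \<open>Multiplication operators\<close>

definition mult_op :: "('v \<Rightarrow> complex) \<Rightarrow> ('v \<Rightarrow> complex) \<Rightarrow> ('v \<Rightarrow> complex)" where
  "mult_op \<psi> f = (\<lambda>v. \<psi> v * f v)"

definition mult_op_bounded ::
    "('v \<Rightarrow> 'v \<Rightarrow> bool) \<Rightarrow> 'v \<Rightarrow> nat \<Rightarrow> nat \<Rightarrow> ('v \<Rightarrow> complex) \<Rightarrow> bool" where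
  "mult_op_bounded adj r m n \<psi> \<longleftrightarrow>
     (\<forall>f\<in>lip_space adj r m. mult_op \<psi> f \<in> lip_space adj r n) \<and>
     (\<exists>C. \<forall>f\<in>lip_space adj r m. lip_norm adj r n (mult_op \<psi> f) \<le> C * lip_norm adj r m f)"

text \<open>The operator norm; meaningful only if the operator is bounded.\<close>

definition mult_op_norm ::
    "('v \<Rightarrow> 'v \<Rightarrow> bool) \<Rightarrow> 'v \<Rightarrow> nat \<Rightarrow> nat \<Rightarrow> ('v \<Rightarrow> complex) \<Rightarrow> real" where
  "mult_op_norm adj r m n \<psi> =
     (SUP f\<in>{f \<in> lip_space adj r m. lip_norm adj r m f \<le> 1}. lip_norm adj r n (mult_op \<psi> f))"

text \<open>The suprema \<open>\<mu>\<close> and \<open>\<nu>\<close> may be infinite and are therefore extended real numbers.\<close>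

definition mu :: "('v \<Rightarrow> 'v \<Rightarrow> bool) \<Rightarrow> 'v \<Rightarrow> ('v \<Rightarrow> complex) \<Rightarrow> nat \<Rightarrow> nat \<Rightarrow> ereal" where
  "mu adj r \<psi> m n =
     (SUP v\<in>UNIV - {r}. ereal (cmod (tree_deriv adj r \<psi> v) *
        ell m (real (tree_dist adj r v)) * Lam n (real (tree_dist adj r v))))"

definition nu :: "('v \<Rightarrow> 'v \<Rightarrow> bool) \<Rightarrow> 'v \<Rightarrow> ('v \<Rightarrow> complex) \<Rightarrow> nat \<Rightarrow> nat \<Rightarrow> ereal" where
  "nu adj r \<psi> m n =
     (SUP v\<in>UNIV - {r}. ereal (cmod (\<psi> (parent adj r v)) *
        Lam n (real (tree_dist adj r v)) / Lam m (real (tree_dist adj r v))))"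

end

theory Submission
  imports Defs
begin

text \<open>
  The sums \<open>S\<^sub>m(N) = \<Sum>j=1..N. 1 / \<Lambda>\<^sub>m(j)\<close> satisfy \<open>S\<^sub>m(N) \<le> \<ell>\<^sub>m(N) \<le> 1 + S\<^sub>m(N)\<close>, since \<open>1 / \<Lambda>\<^sub>m\<close> is
  the derivative of \<open>\<ell>\<^sub>m\<close> and \<open>\<ell>\<^sub>m(1) = 1\<close>. The first inequality bounds the values of \<open>f \<in> \<L>\<^sup>(\<^sup>m\<^sup>)\<close> by
  \<open>\<ell>\<^sub>m\<close>, and the product rule \<open>(\<psi> f)'(v) = \<psi>'(v) f(v) + \<psi>(v\<^sup>-) f'(v)\<close> then gives sufficiency and
  the upper estimate of the norm. For necessity, testing the operator on the indicator function of
  the single vertex \<open>v\<^sup>-\<close> bounds \<open>\<nu>\<close>, and testing it on \<open>v \<mapsto> 1 + S\<^sub>m(|v|)\<close>, whose norm is \<open>2\<close>,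
  bounds \<open>\<mu>\<close>. The lower estimate of the norm comes from the constant function \<open>1\<close>.
\<close>

section \<open>Paths in a rooted tree\<close>

lemma successively_rev_symp:
  "symp P \<Longrightarrow> successively P (rev xs) \<longleftrightarrow> successively P xs"
  unfolding successively_rev by (metis sympD successively_mono)

text \<open>Strip the common initial vertices of the two paths. If they then part at
  \<open>v\<close>, following \<open>q\<close> to its first vertex on \<open>p\<close> and returning
  to \<open>v\<close> along \<open>p\<close> closes a cycle.\<close>

lemma path_unique:
  assumes "symp adj" and "\<nexists>c. is_cycle adj c"
    and "is_path adj v w p" and "is_path adj v w q"
  shows "p = q"
  using assms(3,4)
proof (induction p arbitrary: v q)
  case Nil
  then show ?case by (simp add: is_path_def)
next
  case (Cons v' p)
  have v': "v' = v" using Cons.prems(1) by (simp add: is_path_def)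
  obtain q' where q: "q = v # q'"
    using Cons.prems(2) by (cases q) (auto simp: is_path_def)
  note P = Cons.prems(1)[unfolded v'] and Q = Cons.prems(2)[unfolded q]
  show ?case
  proof (cases "p = [] \<or> q' = []")
    case True
    \<comment> \<open>If one path is the single vertex \<open>v\<close>, then \<open>w = v\<close>,
      and distinctness keeps the other path from coming back to \<open>v\<close>.\<close>
    then have "w = v" using P Q by (auto simp: is_path_def)
    then have "p = []" "q' = []"
      using P Q by (auto simp: is_path_def dest: last_in_set split: if_splits)
    then show ?thesis by (simp add: v' q)
  next
    case False
    then have ne: "p \<noteq> []" "q' \<noteq> []" by auto
    show ?thesis
    proof (cases "hd p = hd q'")
      case True
      have "is_path adj (hd p) w p" "is_path adj (hd p) w q'"
        using P Q ne True by (auto simp: is_path_def successively_Cons)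
      then show ?thesis using Cons.IH q v' by blast
    next
      case diff: False
      \<comment> \<open>The common endpoint \<open>w\<close> guarantees that \<open>q'\<close> meets
        \<open>p\<close>. Taking the first such vertex \<open>x\<close> keeps \<open>q1\<close> off
        \<open>p\<close>, which makes the closed walk below free of repetitions.\<close>
      have "w \<in> set q'" "w \<in> set p"
        using P Q ne last_in_set by (fastforce simp: is_path_def)+
      then have "\<exists>x\<in>set q'. x \<in> set p" by blast
      then obtain q1 x q2 where q': "q' = q1 @ x # q2" and x: "x \<in> set p"
        and q1: "\<forall>y\<in>set q1. y \<notin> set p"
        by (rule split_list_first_propE)
      obtain p1 p2 where p: "p = p1 @ x # p2"
        using x by (meson split_list)
      let ?c = "v # q1 @ x # rev p1"
      \<comment> \<open>Were both segments empty, both paths would step from \<open>v\<close> to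
        \<open>x\<close>, against \<open>diff\<close>. So a third vertex exists besides
        \<open>v\<close> and \<open>x\<close>.\<close>
      have "q1 \<noteq> [] \<or> p1 \<noteq> []" using diff p q' by auto
      then have "length ?c \<ge> 3" by (cases q1; cases p1) auto
      moreover have "distinct ?c"
        using P Q p q' q1 by (auto simp: is_path_def)
      moreover have "successively adj ?c"
      proof -
        have 1: "successively adj ((v # q1) @ [x])"
          using Q q' by (auto simp: is_path_def successively_append_iff successively_Cons hd_append)
        have "successively adj (p1 @ [x])"
          using P p by (auto simp: is_path_def successively_append_iff successively_Cons)
        then have "successively adj (rev (p1 @ [x]))"
          using assms(1) by (simp only: successively_rev_symp)
        with 1 show ?thesis
          by (auto simp: successively_append_iff successively_Cons hd_append)
      qed
      moreover have "adj (last ?c) (hd ?c)"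
      proof -
        have "adj v (hd p)" using P ne by (auto simp: is_path_def successively_Cons)
        moreover have "last ?c = hd p" using p by (cases p1) (auto simp: last_rev)
        ultimately show ?thesis using assms(1) by (auto dest: sympD)
      qed
      ultimately have "is_cycle adj ?c" by (simp add: is_cycle_def)
      then show ?thesis using assms(2) by blast
    qed
  qed
qed

lemma tree_path_eq:
  assumes "is_tree adj" and "is_path adj v w p"
  shows "tree_path adj v w = p"
  unfolding tree_path_def using assms path_unique[of adj v w]
  by (intro the_equality) (auto simp: is_tree_def)

text \<open>Identifies the vertex given by \<open>THE\<close> as the last but one on the path from
  the root: any other neighbor of \<open>v\<close> on that path would close a cycle. Dropping
  \<open>v\<close> leaves the path to the parent.\<close>

lemma parent_exists_path:
  assumes tree: "is_tree adj" and "v \<noteq> r"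
  obtains q where "is_path adj r (parent adj r v) (q @ [parent adj r v])"
    and "is_path adj r v (q @ [parent adj r v, v])"
proof -
  obtain p where p: "is_path adj r v p" using tree by (meson is_tree_def)
  then have "p \<noteq> []" "last p = v" by (auto simp: is_path_def)
  then obtain p' where p': "p = p' @ [v]" by (metis append_butlast_last_id)
  have "p' \<noteq> []" using p p' \<open>v \<noteq> r\<close> by (auto simp: is_path_def)
  then obtain q w where q: "p' = q @ [w]" by (metis append_butlast_last_id)
  have sym: "symp adj" and irr: "irreflp adj" and nc: "\<nexists>c. is_cycle adj c"
    using tree by (auto simp: is_tree_def)
  have path: "is_path adj r v (q @ [w, v])" using p p' q by simp
  then have wv: "adj w v"
    by (auto simp: is_path_def successively_append_iff)
  have "parent adj r v = w"
    unfolding parent_def tree_path_eq[OF tree path]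
  proof (rule the_equality)
    show "adj v w \<and> w \<in> set (q @ [w, v])" using wv sym by (auto dest: sympD)
  next
    fix u assume u: "adj v u \<and> u \<in> set (q @ [w, v])"
    show "u = w"
    proof (rule ccontr)
      assume "u \<noteq> w"
      moreover have "u \<noteq> v" using u irr by (auto dest: irreflpD)
      ultimately have "u \<in> set q" using u by auto
      then obtain q1 q2 where "q = q1 @ u # q2" by (meson split_list)
      \<comment> \<open>The stretch of the path from \<open>u\<close> to \<open>v\<close>, closed by
        the edge between \<open>v\<close> and \<open>u\<close>.\<close>
      then have "is_cycle adj (u # q2 @ [w, v])"
        using path u by (auto simp: is_cycle_def is_path_def successively_append_iff)
      then show False using nc by blast
    qed
  qed
  moreover have "is_path adj r w (q @ [w])"
    using path by (auto simp: is_path_def successively_append_iff hd_append)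
  ultimately show ?thesis using that path by blast
qed

lemma tree_dist_parent:
  assumes "is_tree adj" and "v \<noteq> r"
  shows "tree_dist adj r v = Suc (tree_dist adj r (parent adj r v))"
proof -
  obtain q where "is_path adj r (parent adj r v) (q @ [parent adj r v])"
    and "is_path adj r v (q @ [parent adj r v, v])"
    using parent_exists_path[OF assms] .
  from this[THEN tree_path_eq[OF assms(1)]] show ?thesis
    by (simp add: tree_dist_def)
qed

lemma parent_neq:
  assumes "is_tree adj" and "v \<noteq> r"
  shows "parent adj r v \<noteq> v"
  using tree_dist_parent[OF assms] by auto

lemma tree_dist_root:
  assumes "is_tree adj"
  shows "tree_dist adj r r = 0"
proof -
  have "is_path adj r r [r]" by (simp add: is_path_def)
  then show ?thesis using tree_path_eq[OF assms] by (simp add: tree_dist_def)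
qed

text \<open>Discrete product rule, obtained by adding and subtracting
  \<open>\<psi> (parent adj r v) * f v\<close>. Evaluating \<open>f\<close> at \<open>v\<close> but
  \<open>\<psi>\<close> at the parent is what matches the shapes of \<open>mu\<close> and
  \<open>nu\<close>. At the root both sides vanish.\<close>

lemma tree_deriv_mult:
  "tree_deriv adj r (mult_op \<psi> f) v =
     tree_deriv adj r \<psi> v * f v + \<psi> (parent adj r v) * tree_deriv adj r f v"
  by (simp add: tree_deriv_def mult_op_def algebra_simps)

section \<open>Iterated logarithms\<close>

lemma ell_ge_1: "1 \<le> x \<Longrightarrow> 1 \<le> ell k x"
  by (induction k) auto

lemma ell_mono: "1 \<le> x \<Longrightarrow> x \<le> y \<Longrightarrow> ell k x \<le> ell k y"
proof (induction k)
  case (Suc k)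
  then show ?case using ell_ge_1[of x k] by simp
qed simp

lemma ell_1 [simp]: "ell k 1 = 1"
  by (induction k) auto

lemma Lam_0 [simp]: "Lam 0 x = 1"
  by (simp add: Lam_def)

lemma Lam_Suc: "Lam (Suc k) x = Lam k x * ell k x"
  by (simp add: Lam_def)

lemma Lam_at_1 [simp]: "Lam k 1 = 1"
  by (simp add: Lam_def)

lemma Lam_ge_1: "1 \<le> x \<Longrightarrow> 1 \<le> Lam k x"
  unfolding Lam_def by (intro prod_ge_1) (auto intro: ell_ge_1)

lemma Lam_mono: "1 \<le> x \<Longrightarrow> x \<le> y \<Longrightarrow> Lam k x \<le> Lam k y"
  unfolding Lam_def
  by (intro prod_mono) (auto intro: ell_mono order_trans[OF _ ell_ge_1])

text \<open>The derivative of \<open>ell k\<close> is the decreasing function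
  \<open>1 / Lam k\<close>, so its value at the left end bounds the difference quotient. The
  induction gets this from \<open>ln b - ln a \<le> (b - a) / a\<close> alone.\<close>

lemma ell_diff_le:
  assumes "1 \<le> x" "x \<le> y"
  shows "ell k y - ell k x \<le> (y - x) / Lam k x"
proof (induction k)
  case (Suc k)
  have x: "1 \<le> ell k x" and y: "1 \<le> ell k y" using assms by (auto intro: ell_ge_1)
  have "ell (Suc k) y - ell (Suc k) x \<le> (ell k y - ell k x) / ell k x"
    using x y ln_diff_le[of "ell k y" "ell k x"] by simp
  also have "\<dots> \<le> (y - x) / Lam k x / ell k x"
    using Suc x by (intro divide_right_mono) auto
  finally show ?case by (simp add: Lam_Suc)
qed simp

text \<open>The same estimate with the derivative at the right end, from the logarithm inequality
  with its arguments exchanged.\<close>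

lemma ell_diff_ge:
  assumes "1 \<le> x" "x \<le> y"
  shows "(y - x) / Lam k y \<le> ell k y - ell k x"
proof (induction k)
  case (Suc k)
  have x: "1 \<le> ell k x" and y: "1 \<le> ell k y" using assms by (auto intro: ell_ge_1)
  have "(y - x) / Lam k y / ell k y \<le> (ell k y - ell k x) / ell k y"
    using Suc y by (intro divide_right_mono) auto
  also have "\<dots> \<le> ell (Suc k) y - ell (Suc k) x"
    using x y ln_diff_le[of "ell k x" "ell k y"] by (simp add: diff_divide_distrib)
  finally show ?case by (simp add: Lam_Suc)
qed simp

text \<open>A discrete antiderivative of \<open>1 / Lam k\<close>: it equals \<open>N\<close> for
  \<open>k = 0\<close> and the \<open>N\<close>-th harmonic number for \<open>k = 1\<close>. The
  shift by \<open>Suc\<close> starts the sum at the argument \<open>1\<close>.\<close>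

definition recip_Lam_sum :: "nat \<Rightarrow> nat \<Rightarrow> real" where
  "recip_Lam_sum k N = (\<Sum>j<N. 1 / Lam k (real (Suc j)))"

lemma recip_Lam_sum_0 [simp]: "recip_Lam_sum k 0 = 0"
  by (simp add: recip_Lam_sum_def)

lemma recip_Lam_sum_Suc:
  "recip_Lam_sum k (Suc N) = recip_Lam_sum k N + 1 / Lam k (real (Suc N))"
  by (simp add: recip_Lam_sum_def)

lemma recip_Lam_sum_nonneg: "0 \<le> recip_Lam_sum k N"
  unfolding recip_Lam_sum_def
  by (intro sum_nonneg divide_nonneg_nonneg order_trans[OF _ Lam_ge_1]) auto

text \<open>Both sides equal \<open>1\<close> at \<open>N = 0\<close>, and by
  \<open>ell_diff_ge\<close> each new summand is at most the increment of
  \<open>ell k\<close>.\<close>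

lemma recip_Lam_sum_le_ell: "recip_Lam_sum k (Suc N) \<le> ell k (real (Suc N))"
proof (induction N)
  case (Suc N)
  then show ?case
    using ell_diff_ge[of "real (Suc N)" "real (Suc (Suc N))" k]
    by (simp add: recip_Lam_sum_Suc[of k "Suc N"])
qed (simp add: recip_Lam_sum_Suc)

text \<open>By \<open>ell_diff_le\<close> the increment of \<open>ell k\<close> is at most the
  reciprocal of \<open>Lam k\<close> at the left end, so \<open>N\<close> summands suffice at the
  argument \<open>Suc N\<close>.\<close>

lemma ell_le_recip_Lam_sum: "ell k (real (Suc N)) \<le> 1 + recip_Lam_sum k N"
proof (induction N)
  case (Suc N)
  then show ?case
    using ell_diff_le[of "real (Suc N)" "real (Suc (Suc N))" k]
    by (simp add: recip_Lam_sum_Suc[of k N])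
qed simp

section \<open>Lipschitz spaces\<close>

lemma tree_dist_ge_1:
  "is_tree adj \<Longrightarrow> v \<noteq> r \<Longrightarrow> 1 \<le> real (tree_dist adj r v)"
  by (simp add: tree_dist_parent)

lemma Lam_tree_dist_ge_1:
  "is_tree adj \<Longrightarrow> v \<noteq> r \<Longrightarrow> 1 \<le> Lam k (real (tree_dist adj r v))"
  by (intro Lam_ge_1 tree_dist_ge_1)

lemma lip_spaceI:
  assumes "\<And>v. v \<noteq> r \<Longrightarrow>
    cmod (tree_deriv adj r f v) * Lam k (real (tree_dist adj r v)) \<le> B"
  shows "f \<in> lip_space adj r k"
  unfolding lip_space_def using assms by (auto intro!: bdd_aboveI[of _ B])

text \<open>The vertex \<open>u\<close> makes the index set of the real supremum nonempty, as a
  least upper bound argument requires.\<close>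

lemma lip_norm_le:
  assumes "\<And>v. v \<noteq> r \<Longrightarrow>
    cmod (tree_deriv adj r f v) * Lam k (real (tree_dist adj r v)) \<le> B"
    and "u \<noteq> r"
  shows "lip_norm adj r k f \<le> cmod (f r) + B"
  unfolding lip_norm_def using assms by (auto intro!: cSUP_least)

lemma lip_norm_ge:
  assumes "f \<in> lip_space adj r k" and "v \<noteq> r"
  shows "cmod (f r) + cmod (tree_deriv adj r f v) * Lam k (real (tree_dist adj r v))
           \<le> lip_norm adj r k f"
  using assms by (auto simp: lip_space_def lip_norm_def intro!: cSUP_upper)

lemma lip_norm_ge_root:
  assumes "is_tree adj" and "f \<in> lip_space adj r k" and "u \<noteq> r"
  shows "cmod (f r) \<le> lip_norm adj r k f"
  using lip_norm_ge[OF assms(2,3)] Lam_tree_dist_ge_1[OF assms(1,3), of k]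
  by (smt (verit) mult_nonneg_nonneg norm_ge_zero)

lemma lip_norm_ge_deriv:
  assumes "f \<in> lip_space adj r k" and "v \<noteq> r"
  shows "cmod (tree_deriv adj r f v) * Lam k (real (tree_dist adj r v)) \<le> lip_norm adj r k f"
  using lip_norm_ge[OF assms] by (smt (verit) norm_ge_zero)

text \<open>Sum the increments of \<open>f\<close> along the path from the root. The difference of
  the norm and \<open>cmod (f r)\<close> is the supremum in the definition of the norm, so the edge
  ending at distance \<open>j\<close> contributes at most that difference divided by
  \<open>Lam k j\<close>.\<close>

lemma lip_function_bound:
  assumes tree: "is_tree adj" and f: "f \<in> lip_space adj r k"
  shows "cmod (f v) \<le> cmod (f r)
           + (lip_norm adj r k f - cmod (f r)) * recip_Lam_sum k (tree_dist adj r v)"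
proof (induction "tree_dist adj r v" arbitrary: v)
  case 0
  then have "v = r" using tree_dist_parent[OF tree, of v r] by force
  then show ?case using tree by (simp add: tree_dist_root)
next
  case (Suc N)
  let ?K = "lip_norm adj r k f - cmod (f r)"
  have "v \<noteq> r" using Suc(2) tree_dist_root[OF tree, of r] by auto
  let ?w = "parent adj r v"
  have "tree_dist adj r ?w = N" using tree_dist_parent[OF tree \<open>v \<noteq> r\<close>] Suc(2) by simp
  then have w: "cmod (f ?w) \<le> cmod (f r) + ?K * recip_Lam_sum k N"
    using Suc(1)[of ?w] by simp
  have "cmod (f v - f ?w) * Lam k (real (Suc N)) \<le> ?K"
    using lip_norm_ge[OF f \<open>v \<noteq> r\<close>] \<open>v \<noteq> r\<close> Suc(2) by (simp add: tree_deriv_def)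
  moreover have "0 < Lam k (real (Suc N))" using Lam_ge_1[of "real (Suc N)" k] by simp
  ultimately have "cmod (f v - f ?w) \<le> ?K / Lam k (real (Suc N))"
    by (simp add: pos_le_divide_eq)
  moreover have "cmod (f v) \<le> cmod (f ?w) + cmod (f v - f ?w)"
    by (metis add.commute diff_add_cancel norm_triangle_ineq)
  ultimately show ?case
    using w by (simp add: Suc(2)[symmetric] recip_Lam_sum_Suc distrib_left)
qed

text \<open>Since \<open>ell k\<close> is at least \<open>1\<close>, the term
  \<open>cmod (f r)\<close> may be multiplied by it too. The two parts then add up to the full norm
  with constant exactly \<open>1\<close>, which the sharp upper estimate of the operator norm
  needs.\<close>

lemma lip_function_le_ell:
  assumes tree: "is_tree adj" and f: "f \<in> lip_space adj r k" and "v \<noteq> r"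
  shows "cmod (f v) \<le> lip_norm adj r k f * ell k (real (tree_dist adj r v))"
proof -
  let ?N = "tree_dist adj r v"
  have "recip_Lam_sum k ?N \<le> ell k (real ?N)"
    using tree_dist_parent[OF tree \<open>v \<noteq> r\<close>] recip_Lam_sum_le_ell by metis
  moreover have "0 \<le> lip_norm adj r k f - cmod (f r)"
    using lip_norm_ge_root[OF tree f \<open>v \<noteq> r\<close>] by simp
  ultimately have "cmod (f v) \<le> cmod (f r) + (lip_norm adj r k f - cmod (f r)) * ell k (real ?N)"
    using lip_function_bound[OF tree f, of v] by (smt (verit) mult_left_mono)
  moreover have "cmod (f r) * 1 \<le> cmod (f r) * ell k (real ?N)"
    by (intro mult_left_mono ell_ge_1 tree_dist_ge_1 assms) auto
  ultimately show ?thesis by (simp add: algebra_simps)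
qed

lemma constant_one_lip:
  assumes "u \<noteq> r"
  shows "(\<lambda>_. 1) \<in> lip_space adj r k" and "lip_norm adj r k (\<lambda>_. 1) \<le> 1"
proof -
  have "cmod (tree_deriv adj r (\<lambda>_. 1) v) * Lam k (real (tree_dist adj r v)) \<le> 0" for v
    by (simp add: tree_deriv_def)
  from lip_spaceI[OF this] lip_norm_le[OF this assms]
  show "(\<lambda>_. 1) \<in> lip_space adj r k" "lip_norm adj r k (\<lambda>_. 1) \<le> 1" by auto
qed

section \<open>Multiplication operators\<close>

text \<open>Translates finiteness of \<open>mu\<close> and \<open>nu\<close> into boundedness of
  real families. Nonemptiness excludes the value minus infinity.\<close>

lemma ereal_SUP_finite_iff:
  assumes "A \<noteq> {}"
  shows "\<bar>SUP x\<in>A. ereal (f x)\<bar> \<noteq> \<infinity> \<longleftrightarrow> bdd_above (f ` A)"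
proof
  assume fin: "\<bar>SUP x\<in>A. ereal (f x)\<bar> \<noteq> \<infinity>"
  show "bdd_above (f ` A)"
  proof (rule bdd_aboveI2)
    fix x assume "x \<in> A"
    then have "ereal (f x) \<le> (SUP x\<in>A. ereal (f x))" by (rule SUP_upper)
    then show "f x \<le> real_of_ereal (SUP x\<in>A. ereal (f x))"
      using fin by (metis ereal_less_eq(3) ereal_real)
  qed
next
  assume "bdd_above (f ` A)"
  then obtain b where b: "\<And>x. x \<in> A \<Longrightarrow> f x \<le> b" by (auto simp: bdd_above_def)
  have le: "(SUP x\<in>A. ereal (f x)) \<le> ereal b" using b by (intro SUP_least) auto
  obtain x where "x \<in> A" using assms by blast
  then have "ereal (f x) \<le> (SUP x\<in>A. ereal (f x))" by (rule SUP_upper)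
  with le show "\<bar>SUP x\<in>A. ereal (f x)\<bar> \<noteq> \<infinity>" by auto
qed

text \<open>Sufficiency for arbitrary real bounds \<open>a\<close> and \<open>b\<close>: in the
  product rule, growth of \<open>f\<close> like \<open>ell m\<close> controls the first term by
  \<open>a\<close>, and decay of its derivative like \<open>1 / Lam m\<close> controls the second by
  \<open>b\<close>.\<close>

lemma mult_op_lip:
  assumes tree: "is_tree adj" and u: "u \<noteq> r"
    and a: "\<And>v. v \<noteq> r \<Longrightarrow> cmod (tree_deriv adj r \<psi> v) *
        ell m (real (tree_dist adj r v)) * Lam n (real (tree_dist adj r v)) \<le> a"
    and b: "\<And>v. v \<noteq> r \<Longrightarrow> cmod (\<psi> (parent adj r v)) *
        Lam n (real (tree_dist adj r v)) / Lam m (real (tree_dist adj r v)) \<le> b"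
    and f: "f \<in> lip_space adj r m"
  shows "mult_op \<psi> f \<in> lip_space adj r n"
    and "lip_norm adj r n (mult_op \<psi> f) \<le> (cmod (\<psi> r) + a + b) * lip_norm adj r m f"
proof -
  let ?F = "lip_norm adj r m f"
  have *: "cmod (tree_deriv adj r (mult_op \<psi> f) v) * Lam n (real (tree_dist adj r v)) \<le> (a + b) * ?F"
    if v: "v \<noteq> r" for v
  proof -
    let ?d = "real (tree_dist adj r v)"
    have F: "0 \<le> ?F" using lip_norm_ge_root[OF tree f u] norm_ge_zero order_trans by blast
    have Ln: "1 \<le> Lam n ?d" and Lm: "1 \<le> Lam m ?d"
      using tree v by (auto intro: Lam_tree_dist_ge_1)
    have "cmod (tree_deriv adj r \<psi> v) * cmod (f v) * Lam n ?d
        \<le> cmod (tree_deriv adj r \<psi> v) * (?F * ell m ?d) * Lam n ?d"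
      using lip_function_le_ell[OF tree f v] Ln
      by (intro mult_right_mono mult_left_mono) auto
    also have "\<dots> \<le> a * ?F"
      using mult_right_mono[OF a[OF v] F] by (simp add: mult_ac)
    finally have 1: "cmod (tree_deriv adj r \<psi> v * f v) * Lam n ?d \<le> a * ?F"
      by (simp add: norm_mult)
    \<comment> \<open>Multiplying and dividing by \<open>Lam m\<close> separates the quantity
      bounded by \<open>b\<close> from the one bounded by the norm of \<open>f\<close>.\<close>
    have "cmod (\<psi> (parent adj r v)) * cmod (tree_deriv adj r f v) * Lam n ?d
        = (cmod (\<psi> (parent adj r v)) * Lam n ?d / Lam m ?d) *
          (cmod (tree_deriv adj r f v) * Lam m ?d)"
      using Lm by (simp add: field_simps)
    also have "\<dots> \<le> b * ?F"
    proof (rule mult_mono[OF b[OF v] lip_norm_ge_deriv[OF f v]])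
      have "0 \<le> cmod (\<psi> (parent adj r v)) * Lam n ?d / Lam m ?d" using Ln Lm by simp
      then show "0 \<le> b" using b[OF v] by linarith
      show "0 \<le> cmod (tree_deriv adj r f v) * Lam m ?d" using Lm by simp
    qed
    finally have 2: "cmod (\<psi> (parent adj r v) * tree_deriv adj r f v) * Lam n ?d \<le> b * ?F"
      by (simp add: norm_mult)
    have "cmod (tree_deriv adj r (mult_op \<psi> f) v) * Lam n ?d
        \<le> (cmod (tree_deriv adj r \<psi> v * f v) + cmod (\<psi> (parent adj r v) * tree_deriv adj r f v))
            * Lam n ?d"
      unfolding tree_deriv_mult using Ln by (intro mult_right_mono norm_triangle_ineq) auto
    then show ?thesis using 1 2 by (simp add: distrib_right)
  qed
  from lip_spaceI[OF *] show "mult_op \<psi> f \<in> lip_space adj r n" .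
  have "cmod (\<psi> r) * cmod (f r) \<le> cmod (\<psi> r) * ?F"
    by (intro mult_left_mono lip_norm_ge_root[OF tree f u]) auto
  then show "lip_norm adj r n (mult_op \<psi> f) \<le> (cmod (\<psi> r) + a + b) * ?F"
    using lip_norm_le[OF * u] by (simp add: mult_op_def norm_mult distrib_right)
qed

lemma mult_op_bounded_imp_nu_bounded:
  assumes tree: "is_tree adj" and bounded: "mult_op_bounded adj r m n \<psi>"
  shows "bdd_above ((\<lambda>v. cmod (\<psi> (parent adj r v)) *
        Lam n (real (tree_dist adj r v)) / Lam m (real (tree_dist adj r v))) ` (UNIV - {r}))"
proof -
  obtain C where map: "\<And>f. f \<in> lip_space adj r m \<Longrightarrow> mult_op \<psi> f \<in> lip_space adj r n"
    and C: "\<And>f. f \<in> lip_space adj r m \<Longrightarrow>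
              lip_norm adj r n (mult_op \<psi> f) \<le> C * lip_norm adj r m f"
    using bounded by (auto simp: mult_op_bounded_def)
  have "cmod (\<psi> (parent adj r v)) *
        Lam n (real (tree_dist adj r v)) / Lam m (real (tree_dist adj r v)) \<le> \<bar>C\<bar> * 2"
    if v: "v \<noteq> r" for v
  proof -
    let ?d = "real (tree_dist adj r v)" and ?w = "parent adj r v"
    define f :: "'a \<Rightarrow> complex" where "f = (\<lambda>x. if x = ?w then 1 else 0)"
    have L: "1 \<le> Lam m ?d" by (rule Lam_tree_dist_ge_1[OF tree v])
    have *: "cmod (tree_deriv adj r f x) * Lam m (real (tree_dist adj r x)) \<le> Lam m ?d"
      if x: "x \<noteq> r" for x
    \<comment> \<open>The derivative of the indicator lives on \<open>?w\<close> and its children,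
      none farther from the root than \<open>v\<close>, so monotonicity of \<open>Lam m\<close>
      applies.\<close>
    proof (cases "x = ?w \<or> parent adj r x = ?w")
      case True
      then have "tree_dist adj r x \<le> tree_dist adj r v"
        using tree_dist_parent[OF tree v] tree_dist_parent[OF tree x] by auto
      then have "Lam m (real (tree_dist adj r x)) \<le> Lam m ?d"
        using tree_dist_ge_1[OF tree x] by (intro Lam_mono) auto
      moreover have "cmod (tree_deriv adj r f x) \<le> 1" by (simp add: tree_deriv_def f_def)
      ultimately show ?thesis
        using Lam_tree_dist_ge_1[OF tree x, of m] L
        by (smt (verit) mult_left_le_one_le norm_ge_zero)
    next
      case False
      then show ?thesis using L by (simp add: tree_deriv_def f_def)
    qed
    have f: "f \<in> lip_space adj r m" by (rule lip_spaceI[OF *])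
    have "lip_norm adj r m f \<le> cmod (f r) + Lam m ?d" by (rule lip_norm_le[OF * v])
    \<comment> \<open>The factor \<open>2\<close> absorbs \<open>cmod (f r)\<close>, which is
      \<open>1\<close> when \<open>?w\<close> is the root.\<close>
    then have nf: "lip_norm adj r m f \<le> 2 * Lam m ?d"
      using L by (simp add: f_def split: if_splits)
    have nf0: "0 \<le> lip_norm adj r m f"
      using lip_norm_ge_root[OF tree f v] norm_ge_zero order_trans by blast
    have "cmod (tree_deriv adj r (mult_op \<psi> f) v) = cmod (\<psi> ?w)"
      using v parent_neq[OF tree v] by (simp add: tree_deriv_def mult_op_def f_def)
    then have "cmod (\<psi> ?w) * Lam n ?d \<le> lip_norm adj r n (mult_op \<psi> f)"
      using lip_norm_ge_deriv[OF map[OF f] v] by simp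
    also have "\<dots> \<le> C * lip_norm adj r m f" by (rule C[OF f])
    \<comment> \<open>The sign of \<open>C\<close> is not known, so its absolute value is taken
      before the norm is enlarged.\<close>
    also have "\<dots> \<le> \<bar>C\<bar> * (2 * Lam m ?d)"
      using nf nf0 by (intro mult_mono) auto
    finally show ?thesis using L by (simp add: pos_divide_le_eq mult_ac)
  qed
  then show ?thesis by (intro bdd_aboveI2) auto
qed

lemma mult_op_bounded_imp_mu_bounded:
  assumes tree: "is_tree adj" and bounded: "mult_op_bounded adj r m n \<psi>"
  shows "bdd_above ((\<lambda>v. cmod (tree_deriv adj r \<psi> v) *
        ell m (real (tree_dist adj r v)) * Lam n (real (tree_dist adj r v))) ` (UNIV - {r}))"
proof -
  obtain C where map: "\<And>f. f \<in> lip_space adj r m \<Longrightarrow> mult_op \<psi> f \<in> lip_space adj r n"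
    and C: "\<And>f. f \<in> lip_space adj r m \<Longrightarrow>
              lip_norm adj r n (mult_op \<psi> f) \<le> C * lip_norm adj r m f"
    using bounded by (auto simp: mult_op_bounded_def)
  \<comment> \<open>Isolating the term with the derivative of \<open>\<psi>\<close> in the product
    rule leaves a term of the type bounded by \<open>nu\<close>, so that bound comes first.\<close>
  obtain b where b: "\<And>v. v \<noteq> r \<Longrightarrow> cmod (\<psi> (parent adj r v)) *
        Lam n (real (tree_dist adj r v)) / Lam m (real (tree_dist adj r v)) \<le> b"
    using mult_op_bounded_imp_nu_bounded[OF assms] by (auto simp: bdd_above_def)
  define f :: "'a \<Rightarrow> complex"
    where "f = (\<lambda>v. complex_of_real (1 + recip_Lam_sum m (tree_dist adj r v)))"
  have deriv: "tree_deriv adj r f v = complex_of_real (1 / Lam m (real (tree_dist adj r v)))"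
    if "v \<noteq> r" for v
    using that tree_dist_parent[OF tree that]
    by (simp add: tree_deriv_def f_def recip_Lam_sum_Suc)
  have *: "cmod (tree_deriv adj r f v) * Lam m (real (tree_dist adj r v)) \<le> 1"
    if v: "v \<noteq> r" for v
    using Lam_tree_dist_ge_1[OF tree v, of m] by (simp add: deriv[OF v] norm_divide)
  have f: "f \<in> lip_space adj r m" by (rule lip_spaceI[OF *])
  have "cmod (tree_deriv adj r \<psi> v) *
        ell m (real (tree_dist adj r v)) * Lam n (real (tree_dist adj r v)) \<le> \<bar>C\<bar> * 2 + b"
    if v: "v \<noteq> r" for v
  proof -
    let ?d = "real (tree_dist adj r v)" and ?w = "parent adj r v"
    have Ln: "1 \<le> Lam n ?d" and Lm: "1 \<le> Lam m ?d"
      using tree v by (auto intro: Lam_tree_dist_ge_1)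
    have "lip_norm adj r m f \<le> cmod (f r) + 1" by (rule lip_norm_le[OF * v])
    \<comment> \<open>At the root the sum is empty, so \<open>f r = 1\<close>; the derivative part
      adds at most \<open>1\<close>.\<close>
    then have nf: "lip_norm adj r m f \<le> 2"
      using tree by (simp add: f_def tree_dist_root)
    have nf0: "0 \<le> lip_norm adj r m f"
      using lip_norm_ge_root[OF tree f v] norm_ge_zero order_trans by blast
    have "ell m ?d \<le> 1 + recip_Lam_sum m (tree_dist adj r ?w)"
      using ell_le_recip_Lam_sum by (simp add: tree_dist_parent[OF tree v] del: of_nat_Suc)
    also have "\<dots> \<le> 1 + recip_Lam_sum m (tree_dist adj r v)"
      using Lm tree_dist_parent[OF tree v] by (simp add: recip_Lam_sum_Suc)
    also have "\<dots> = cmod (f v)"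
      unfolding f_def norm_of_real using recip_Lam_sum_nonneg[of m "tree_dist adj r v"] by simp
    finally have "cmod (tree_deriv adj r \<psi> v) * ell m ?d * Lam n ?d
        \<le> cmod (tree_deriv adj r \<psi> v) * cmod (f v) * Lam n ?d"
      using Ln by (intro mult_right_mono mult_left_mono) auto
    \<comment> \<open>The product rule solved for the term containing
      \<open>tree_deriv adj r \<psi> v\<close>.\<close>
    also have "\<dots> = cmod (tree_deriv adj r (mult_op \<psi> f) v - \<psi> ?w * tree_deriv adj r f v) * Lam n ?d"
      by (simp add: tree_deriv_mult norm_mult)
    also have "\<dots> \<le> (cmod (tree_deriv adj r (mult_op \<psi> f) v) + cmod (\<psi> ?w * tree_deriv adj r f v))
                    * Lam n ?d"
      using Ln by (intro mult_right_mono norm_triangle_ineq4) auto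
    also have "\<dots> = cmod (tree_deriv adj r (mult_op \<psi> f) v) * Lam n ?d
                    + cmod (\<psi> ?w) * Lam n ?d / Lam m ?d"
      using Lm by (simp add: deriv[OF v] norm_mult norm_divide distrib_right)
    also have "cmod (tree_deriv adj r (mult_op \<psi> f) v) * Lam n ?d \<le> lip_norm adj r n (mult_op \<psi> f)"
      by (rule lip_norm_ge_deriv[OF map[OF f] v])
    also have "\<dots> \<le> C * lip_norm adj r m f" by (rule C[OF f])
    also have "\<dots> \<le> \<bar>C\<bar> * 2"
      using nf nf0 by (intro mult_mono) auto
    finally show ?thesis using b[OF v] by simp
  qed
  then show ?thesis by (intro bdd_aboveI2) auto
qed

theorem theorem3p2:
  fixes adj :: "'v \<Rightarrow> 'v \<Rightarrow> bool" and r :: 'v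
    and \<psi> :: "'v \<Rightarrow> complex" and m n :: nat
  assumes "is_tree adj"
    and "infinite (UNIV :: 'v set)"
    and "\<And>v. \<not> terminal adj v"
    and "m \<noteq> n"
  shows "(mult_op_bounded adj r m n \<psi> \<longleftrightarrow>
            \<bar>mu adj r \<psi> m n\<bar> \<noteq> \<infinity> \<and> \<bar>nu adj r \<psi> m n\<bar> \<noteq> \<infinity>) \<and>
         (mult_op_bounded adj r m n \<psi> \<longrightarrow>
            lip_norm adj r n \<psi> \<le> mult_op_norm adj r m n \<psi> \<and>
            ereal (mult_op_norm adj r m n \<psi>) \<le> ereal (cmod (\<psi> r)) + mu adj r \<psi> m n + nu adj r \<psi> m n)"
proof -
  note tree = assms(1)
  \<comment> \<open>An infinite vertex set has a vertex other than the root, so all suprema run over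
    a nonempty set.\<close>
  have "UNIV \<noteq> {r}" using assms(2) by (metis finite.emptyI finite.insertI)
  then have ne: "UNIV - {r} \<noteq> {}" by auto
  then obtain u where u: "u \<noteq> r" by auto
  let ?fin = "\<bar>mu adj r \<psi> m n\<bar> \<noteq> \<infinity> \<and> \<bar>nu adj r \<psi> m n\<bar> \<noteq> \<infinity>"
  have fin_if_bounded: ?fin if "mult_op_bounded adj r m n \<psi>"
  proof
    show "\<bar>mu adj r \<psi> m n\<bar> \<noteq> \<infinity>"
      unfolding mu_def ereal_SUP_finite_iff[OF ne]
      by (rule mult_op_bounded_imp_mu_bounded[OF tree that])
    show "\<bar>nu adj r \<psi> m n\<bar> \<noteq> \<infinity>"
      unfolding nu_def ereal_SUP_finite_iff[OF ne]
      by (rule mult_op_bounded_imp_nu_bounded[OF tree that])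
  qed
  \<comment> \<open>One estimate serves both the sufficiency and the upper bound of the operator
    norm.\<close>
  have bound: "\<exists>a b. mu adj r \<psi> m n = ereal a \<and> nu adj r \<psi> m n = ereal b \<and>
      (\<forall>f\<in>lip_space adj r m. mult_op \<psi> f \<in> lip_space adj r n \<and>
         lip_norm adj r n (mult_op \<psi> f) \<le> (cmod (\<psi> r) + a + b) * lip_norm adj r m f)"
    if finite: ?fin
  proof -
    obtain a b where a: "mu adj r \<psi> m n = ereal a" and b: "nu adj r \<psi> m n = ereal b"
      using finite by (metis ereal_real)
    have "cmod (tree_deriv adj r \<psi> v) *
        ell m (real (tree_dist adj r v)) * Lam n (real (tree_dist adj r v)) \<le> a"
      if "v \<noteq> r" for v
      unfolding ereal_less_eq(3)[symmetric] a[symmetric] mu_def using that by (intro SUP_upper) auto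
    moreover have "cmod (\<psi> (parent adj r v)) *
        Lam n (real (tree_dist adj r v)) / Lam m (real (tree_dist adj r v)) \<le> b"
      if "v \<noteq> r" for v
      unfolding ereal_less_eq(3)[symmetric] b[symmetric] nu_def using that by (intro SUP_upper) auto
    ultimately show ?thesis
      using mult_op_lip[OF tree u, of \<psi> m n a b] a b by blast
  qed
  have bounded_if_fin: "mult_op_bounded adj r m n \<psi>" if ?fin
    using bound[OF that] by (auto simp: mult_op_bounded_def)
  have norms: "lip_norm adj r n \<psi> \<le> mult_op_norm adj r m n \<psi> \<and>
      ereal (mult_op_norm adj r m n \<psi>) \<le> ereal (cmod (\<psi> r)) + mu adj r \<psi> m n + nu adj r \<psi> m n"
    if bounded: "mult_op_bounded adj r m n \<psi>"
  proof -
    let ?ball = "{f \<in> lip_space adj r m. lip_norm adj r m f \<le> 1}"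
    obtain a b where ab: "mu adj r \<psi> m n = ereal a" "nu adj r \<psi> m n = ereal b"
      and le: "\<And>f. f \<in> lip_space adj r m \<Longrightarrow>
         lip_norm adj r n (mult_op \<psi> f) \<le> (cmod (\<psi> r) + a + b) * lip_norm adj r m f"
      using bound[OF fin_if_bounded[OF bounded]] by blast
    have one: "(\<lambda>_. 1) \<in> ?ball"
      using constant_one_lip[OF u, of adj] by auto
    \<comment> \<open>Nonnegative \<open>a\<close> and \<open>b\<close> let the factor
      \<open>lip_norm adj r m f \<le> 1\<close> be dropped on the unit ball.\<close>
    have "0 \<le> a"
    proof -
      have "0 \<le> cmod (tree_deriv adj r \<psi> u) *
        ell m (real (tree_dist adj r u)) * Lam n (real (tree_dist adj r u))"
        using ell_ge_1[OF tree_dist_ge_1[OF tree u], of m] Lam_tree_dist_ge_1[OF tree u, of n]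
        by simp
      also have "ereal \<dots> \<le> mu adj r \<psi> m n"
        unfolding mu_def using u by (intro SUP_upper) auto
      finally show ?thesis using ab by (simp add: zero_ereal_def)
    qed
    moreover have "0 \<le> b"
    proof -
      have "0 \<le> cmod (\<psi> (parent adj r u)) *
        Lam n (real (tree_dist adj r u)) / Lam m (real (tree_dist adj r u))"
        using Lam_tree_dist_ge_1[OF tree u, of n] Lam_tree_dist_ge_1[OF tree u, of m] by simp
      also have "ereal \<dots> \<le> nu adj r \<psi> m n"
        unfolding nu_def using u by (intro SUP_upper) auto
      finally show ?thesis using ab by (simp add: zero_ereal_def)
    qed
    ultimately have K: "0 \<le> cmod (\<psi> r) + a + b" by simp
    have ball: "lip_norm adj r n (mult_op \<psi> f) \<le> cmod (\<psi> r) + a + b" if "f \<in> ?ball" for f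
      using le[of f] mult_left_mono[of "lip_norm adj r m f" 1, OF _ K] that by simp
    \<comment> \<open>The constant function lies in the unit ball and is mapped to
      \<open>\<psi>\<close>; \<open>ball\<close> ensures that the real supremum is over a bounded
      set.\<close>
    have "lip_norm adj r n (mult_op \<psi> (\<lambda>_. 1)) \<le> mult_op_norm adj r m n \<psi>"
      unfolding mult_op_norm_def using ball one by (intro cSUP_upper) (auto intro!: bdd_aboveI2)
    moreover have "mult_op \<psi> (\<lambda>_. 1) = \<psi>" by (simp add: mult_op_def)
    moreover have "mult_op_norm adj r m n \<psi> \<le> cmod (\<psi> r) + a + b"
      unfolding mult_op_norm_def using ball one by (intro cSUP_least) auto
    ultimately show ?thesis by (simp add: ab)
  qed
  show ?thesis by (rule conjI[OF iffI[OF fin_if_bounded bounded_if_fin] impI[OF norms]])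
qed

end
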